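(* Let $\mu$ be Lebesgue measure on $[0,1]$, for $t\in[0,1]$ let $t^0=[0,t]$ and $t^1=[1-t,1]$, and let $\mathcal{I}_0=\{a^0 : 0\le a\le 1\}$. Define on $\mathcal{I}_0$ the operations $a^0\oplus b^0=[\mu(a^0\cup b^1)]^0$ and $\neg a^0=[\mu([0,1]\setminus a^0)]^0$, and let $0=0^0=[0,0]$ and $1=1^0=[0,1]$. Then $(\mathcal{I}_0,\oplus,\neg,0,1)$ is an MV-algebra.
   Context: In $[\mu(X)]^0$ the real number $\mu(X)\in[0,1]$ plays the role of $t$, i.e. $[\mu(X)]^0=[0,\mu(X)]$. An MV-algebra is a structure $(A,\oplus,\neg,0,1)$ such that $(A,\oplus,0)$ is a commutative monoid with identity $0$, and for all $x,y\in A$: (i) $\neg(\neg x)=x$; (ii) $1\oplus x=1$; (iii) $x\oplus\neg 0=\neg 0$; (iv) $\neg(\neg x\oplus y)\oplus y=\neg(\neg y\oplus x)\oplus x$. *)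

theory Defs
  imports "HOL-Analysis.Analysis" "HOL-Algebra.Group"
begin

(* Closure of A under oplus and zero \<in> A are part of HOL-Algebra's comm_monoid. *)
locale mv_algebra =
  fixes A :: "'a set"
    and oplus :: "'a \<Rightarrow> 'a \<Rightarrow> 'a"
    and neg :: "'a \<Rightarrow> 'a"
    and zero :: 'a
    and one :: 'a
  assumes add_comm_monoid: "Group.comm_monoid \<lparr>carrier = A, mult = oplus, one = zero\<rparr>"
    and neg_closed: "x \<in> A \<Longrightarrow> neg x \<in> A"
    and one_closed: "one \<in> A"
    and neg_neg: "x \<in> A \<Longrightarrow> neg (neg x) = x"
    and one_oplus: "x \<in> A \<Longrightarrow> oplus one x = one"
    and oplus_neg_zero: "x \<in> A \<Longrightarrow> oplus x (neg zero) = neg zero"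
    and lukasiewicz: "x \<in> A \<Longrightarrow> y \<in> A \<Longrightarrow>
          oplus (neg (oplus (neg x) y)) y = oplus (neg (oplus (neg y) x)) x"

abbreviation \<mu> :: "real set \<Rightarrow> real" where
  "\<mu> \<equiv> measure (lebesgue_on {0..1})"

(* sup0 t and sup1 t are the intervals written t^0 and t^1, for t in [0,1]. *)
definition sup0 :: "real \<Rightarrow> real set" where
  "sup0 t = {0..t}"

definition sup1 :: "real \<Rightarrow> real set" where
  "sup1 t = {1 - t..1}"

definition I0 :: "real set set" where
  "I0 = {sup0 a |a. 0 \<le> a \<and> a \<le> 1}"

(* The parameter b of an interval B = b^0; it is unique by inj_on_sup0. *)
definition param :: "real set \<Rightarrow> real" where
  "param B = inv_into {0..1} sup0 B"

definition I0_oplus :: "real set \<Rightarrow> real set \<Rightarrow> real set" where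
  "I0_oplus A B = sup0 (\<mu> (A \<union> sup1 (param B)))"

definition I0_neg :: "real set \<Rightarrow> real set" where
  "I0_neg A = sup0 (\<mu> ({0..1} - A))"

lemma inj_on_sup0: "inj_on sup0 {0..1}"
  by (auto simp: inj_on_def sup0_def Icc_eq_Icc)

lemma param_sup0: "0 \<le> b \<Longrightarrow> b \<le> 1 \<Longrightarrow> param (sup0 b) = b"
  by (simp add: param_def inv_into_f_f[OF inj_on_sup0])

lemma I0_oplus_sup0:
  "0 \<le> b \<Longrightarrow> b \<le> 1 \<Longrightarrow> I0_oplus (sup0 a) (sup0 b) = sup0 (\<mu> (sup0 a \<union> sup1 b))"
  by (simp add: I0_oplus_def param_sup0)

end

theory Submission
  imports Defs
begin

text \<open>Up to the parametrisation \<open>t \<mapsto> t\<^sup>0\<close> the operations are the truncated sum \<open>min 1 (a + b)\<close> and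
  the complement \<open>1 - a\<close>: the intervals \<open>a\<^sup>0\<close> and \<open>b\<^sup>1\<close> are disjoint when \<open>a + b < 1\<close>, and cover
  \<open>[0,1]\<close> otherwise. The axioms are then those of the standard MV-algebra on \<open>[0,1]\<close>; both sides of
  the Lukasiewicz axiom are \<open>max a b\<close>.\<close>

lemma measure_sup0_Un_sup1:
  assumes "a \<in> {0..1}" "b \<in> {0..1}"
  shows "\<mu> (sup0 a \<union> sup1 b) = min 1 (a + b)"
proof -
  have sub: "{0..a} \<union> {1 - b..1} \<subseteq> {0..1}"
    using assms by auto
  have "\<mu> (sup0 a \<union> sup1 b) = measure lebesgue ({0..a} \<union> {1 - b..1})"
    unfolding sup0_def sup1_def by (rule measure_restrict_space) (use sub in auto)
  also have "\<dots> = min 1 (a + b)"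
  proof (cases "a + b < 1")
    case True
    then have "{0..a} \<inter> {1 - b..1} = {}"
      by auto
    then have "measure lebesgue ({0..a} \<union> {1 - b..1}) =
        measure lebesgue {0..a} + measure lebesgue {1 - b..1}"
      \<comment> \<open>\<open>measure_Un2\<close> adds the measure of
        \<open>{1 - b..1} - {0..a}\<close>; disjointness makes this all of
        \<open>{1 - b..1}\<close>.\<close>
      by (intro measure_Un2[THEN trans]) (auto simp: Diff_triv Int_commute)
    with True assms show ?thesis
      by simp
  next
    \<comment> \<open>At \<open>a + b = 1\<close> the intervals share just the point
      \<open>a\<close>, so they already cover.\<close>
    case False
    then have "{0..a} \<union> {1 - b..1} = {0..1}"
      using assms by auto
    with False show ?thesis
      by simp
  qed
  finally show ?thesis .
qed

lemma measure_Diff_sup0: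
  assumes "a \<in> {0..1}"
  shows "\<mu> ({0..1} - sup0 a) = 1 - a"
proof -
  \<comment> \<open>The endpoint \<open>a\<close> is lost, but it is a null set.\<close>
  have "{0..1} - {0..a} = {a<..1}"
    using assms by auto
  moreover have "\<mu> {a<..1} = measure lebesgue {a<..1}"
    by (rule measure_restrict_space) (use assms in auto)
  ultimately have "\<mu> ({0..1} - sup0 a) = measure lebesgue {a<..1}"
    by (simp add: sup0_def)
  with assms show ?thesis
    by simp
qed

lemma I0_oplus_eq_min:
  assumes "a \<in> {0..1}" "b \<in> {0..1}"
  shows "I0_oplus (sup0 a) (sup0 b) = sup0 (min 1 (a + b))"
  using assms by (simp add: I0_oplus_sup0 measure_sup0_Un_sup1)

lemma I0_neg_eq_diff:
  assumes "a \<in> {0..1}"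
  shows "I0_neg (sup0 a) = sup0 (1 - a)"
  using assms by (simp add: I0_neg_def measure_Diff_sup0)

lemma I0_eq_image: "I0 = sup0 ` {0..1}"
  by (auto simp: I0_def)

theorem theorem3:
  shows "mv_algebra I0 I0_oplus I0_neg (sup0 0) (sup0 1)"
proof (rule mv_algebra.intro)
  show "Group.comm_monoid \<lparr>carrier = I0, mult = I0_oplus, one = sup0 0\<rparr>"
    \<comment> \<open>Interval equations are reduced to equations between parameters;
      \<open>equalityI\<close> would split them into inclusions instead.\<close>
    by (rule comm_monoidI)
      (auto simp: I0_eq_image I0_oplus_eq_min 
        intro!: arg_cong[where f = sup0] del: equalityI)
qed (auto simp: I0_eq_image I0_oplus_eq_min I0_neg_eq_diff 
        intro!: arg_cong[where f = sup0] del: equalityI)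

end
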